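(* Let $\lambda>0$, let $\mathcal F:\mathscr P(\Theta)\to\mathbb R$ be $\lambda$-relative strongly convex on $\mathscr P(\Theta)$, let $\rho^\ast$ be a global minimizer of $\mathcal F$ over $\mathscr P(\Theta)$, and let $\tau>0$ be a constant step size. Let $\{\rho_k^{\mathrm{err}}:k\ge0\}\subset\mathscr P^r(\Theta)$ with $\rho_0^{\mathrm{err}}=\rho_0$ be iterates of the inexact implicit KL proximal descent algorithm with $\tau_k\equiv\tau$, meaning that, with error tolerances $\varepsilon_k\ge0$ $(k\ge1)$, the functions $$\eta_k(\theta)=\frac{\delta\mathcal F}{\delta\rho}(\rho_k^{\mathrm{err}})(\theta)+\frac1\tau\log\frac{\rho_k^{\mathrm{err}}}{\rho_{k-1}^{\mathrm{err}}}(\theta)$$ satisfy $\sup_{\theta,\theta'\in\Theta}|\eta_k(\theta)-\eta_k(\theta')|\le\varepsilon_k$ for each $k\ge1$. Then: (1) If $\varepsilon_k\le\kappa\varepsilon^k$ for all $k\ge1$, for some $\kappa>0$ and $0<\varepsilon<1$ satisfying $\varepsilon\sqrt{1+\lambda\tau/2}\ne1$, then there exists a constant $C=C(\tau,\lambda,\varepsilon)>0$ such that for all $k\ge1$ $$D_{\mathrm{KL}}(\rho^\ast\,\|\,\rho_k^{\mathrm{err}})\le\frac{C\kappa^2+2D_{\mathrm{KL}}(\rho^\ast\,\|\,\rho_0)}{\big(\min\{\varepsilon^{-2},\,1+\lambda\tau/2\}\big)^k}.$$ (2) If $\varepsilon_k\le\varepsilon k^{-\alpha}$ for all $k\ge1$,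 for some $\varepsilon,\alpha>0$, then there exists a constant $C=C(\tau,\lambda,\alpha)>0$ such that for all $k\ge1$ $$D_{\mathrm{KL}}(\rho^\ast\,\|\,\rho_k^{\mathrm{err}})\le\frac{2D_{\mathrm{KL}}(\rho^\ast\,\|\,\rho_0)}{(1+\lambda\tau/2)^k}+\frac{C\varepsilon^2}{k^{2\alpha}}.$$
   Context: $\Theta\subset\mathbb R^d$; $\mathscr P(\Theta)$ is the set of probability distributions on $\Theta$ and $\mathscr P^r(\Theta)$ the subset of those admitting a density with respect to Lebesgue measure; densities are denoted by the same letter as the measure. $D_{\mathrm{KL}}(\rho\,\|\,\rho')$ is the Kullback-Leibler divergence ($+\infty$ if $\rho\not\ll\rho'$). The paper notes that this result requires $\rho^\ast$ to have a density, i.e. $\rho^\ast\in\mathscr P^r(\Theta)$. The inexact algorithm approximates the exact implicit step $\rho_k=\arg\min_{\rho\in\mathscr P(\Theta)}\mathcal F(\rho)+\frac1{\tau_k}D_{\mathrm{KL}}(\rho\,\|\,\rho_{k-1})$; $\eta_k$ is the first variation of that step's objective (with $\rho_{k-1}$ replaced by $\rho_{k-1}^{\mathrm{err}}$) at $\rho_k^{\mathrm{err}}$, which is constant for an exact solution. $\mathcal F:\mathscr P(\Theta)\to\mathbb R$ is lower semi-continuous. A measure $\rho\in\mathscr P(\Theta)$ is regular for $\mathcal F$ if $\mathcal F(\varepsilon\rho+(1-\varepsilon)\rho')<\infty$ for all $\varepsilon\in(0,1)$ and all $\rho'\in\mathscr P^r(\Theta)$ with compact support and bounded density. For regular $\rho$,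 the first variation of $\mathcal F$ at $\rho$ is a map $\frac{\delta\mathcal F}{\delta\rho}(\rho):\Theta\to\mathbb R$ (unique up to an additive constant, assumed to exist) such that $\frac{\mathrm d}{\mathrm d\varepsilon}\mathcal F(\rho+\varepsilon\chi)\big|_{\varepsilon=0}=\int_\Theta\frac{\delta\mathcal F}{\delta\rho}(\rho)\,\mathrm d\chi$ for any perturbation $\chi=\rho'-\rho$ with such $\rho'$. For $\lambda>0$, $\mathcal F$ is $\lambda$-relative strongly convex (relative to KL) if for any pair of regular probability measures $\rho,\rho'\in\mathscr P^r(\Theta)$ such that $\mathcal F(\rho)$ is finite, $$\mathcal F(\rho')\ge\mathcal F(\rho)+\int\frac{\delta\mathcal F}{\delta\rho}(\rho)\,\mathrm d(\rho'-\rho)+\lambda D_{\mathrm{KL}}(\rho'\,\|\,\rho).$$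
   Formalization: F takes values in (-∞,+∞] instead of ℝ (a real-valued F cannot be relatively strongly convex), and the minimizer ρ* is assumed regular for F (as well as having a density); without regularity of ρ* the bound can fail. *)

theory Defs
  imports "HOL-Probability.Probability"
begin

section \<open>Probability measures on a subset of a Euclidean space\<close>

definition prob_on :: "'a::euclidean_space set \<Rightarrow> 'a measure set" where
  "prob_on \<Theta> = {\<rho>. prob_space \<rho> \<and> sets \<rho> = sets (restrict_space borel \<Theta>)}"

definition lebesgue_on_set :: "'a::euclidean_space set \<Rightarrow> 'a measure" where
  "lebesgue_on_set \<Theta> = restrict_space lborel \<Theta>"

definition has_density ::
    "'a::euclidean_space set \<Rightarrow> 'a measure \<Rightarrow> ('a \<Rightarrow> real) \<Rightarrow> bool" where
  "has_density \<Theta> \<rho> r \<longleftrightarrow>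
     r \<in> borel_measurable (lebesgue_on_set \<Theta>) \<and> (\<forall>x\<in>\<Theta>. 0 \<le> r x) \<and>
     \<rho> = density (lebesgue_on_set \<Theta>) (\<lambda>x. ennreal (r x))"

definition prob_dens_on :: "'a::euclidean_space set \<Rightarrow> 'a measure set" where
  "prob_dens_on \<Theta> = {\<rho> \<in> prob_on \<Theta>. \<exists>r. has_density \<Theta> \<rho> r}"

text \<open>Compactness of the support is meant in the subspace \<open>\<Theta>\<close>, so that it amounts to
  \<open>\<rho>\<close> being carried by some compact subset of \<open>\<Theta>\<close>.\<close>

definition test_measures :: "'a::euclidean_space set \<Rightarrow> 'a measure set" where
  "test_measures \<Theta> = {\<rho> \<in> prob_on \<Theta>.
     (\<exists>K. compact K \<and> K \<subseteq> \<Theta> \<and> emeasure \<rho> K = 1) \<and>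
     (\<exists>r B. has_density \<Theta> \<rho> r \<and> (\<forall>x\<in>\<Theta>. r x \<le> B))}"

text \<open>\<open>mixture e \<rho> \<rho>'\<close> is \<open>e \<rho> + (1 - e) \<rho>'\<close>.\<close>

definition mixture :: "real \<Rightarrow> 'a measure \<Rightarrow> 'a measure \<Rightarrow> 'a measure" where
  "mixture e \<rho> \<rho>' = measure_of (space \<rho>) (sets \<rho>)
     (\<lambda>A. ennreal e * emeasure \<rho> A + ennreal (1 - e) * emeasure \<rho>' A)"

lemma sets_mixture [simp]: "sets (mixture e \<rho> \<rho>') = sets \<rho>"
  by (simp add: mixture_def sets.sigma_sets_eq)

lemma space_mixture [simp]: "space (mixture e \<rho> \<rho>') = space \<rho>"
  by (simp add: mixture_def)

lemma emeasure_mixture: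
  assumes "sets \<rho>' = sets \<rho>" "A \<in> sets \<rho>"
  shows "emeasure (mixture e \<rho> \<rho>') A
           = ennreal e * emeasure \<rho> A + ennreal (1 - e) * emeasure \<rho>' A"
proof -
  let ?\<mu> = "\<lambda>A. ennreal e * emeasure \<rho> A + ennreal (1 - e) * emeasure \<rho>' A"
  have "countably_additive (sets \<rho>) ?\<mu>"
  proof (rule countably_additiveI)
    fix B :: "nat \<Rightarrow> 'a set"
    assume B: "range B \<subseteq> sets \<rho>" "disjoint_family B"
    have "(\<Sum>i. ?\<mu> (B i))
        = ennreal e * (\<Sum>i. emeasure \<rho> (B i)) + ennreal (1 - e) * (\<Sum>i. emeasure \<rho>' (B i))"
      by (simp add: suminf_add[symmetric])
    then show "(\<Sum>i. ?\<mu> (B i)) = ?\<mu> (\<Union>i. B i)"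
      using B assms(1) by (simp add: suminf_emeasure)
  qed
  moreover have "positive (sets \<rho>) ?\<mu>"
    by (simp add: positive_def)
  ultimately show ?thesis
    unfolding mixture_def using assms(2)
    by (intro emeasure_measure_of_sigma sets.sigma_algebra_axioms) auto
qed

lemma mixture_1: "sets \<rho>' = sets \<rho> \<Longrightarrow> mixture 1 \<rho> \<rho>' = \<rho>"
  by (rule measure_eqI) (simp_all add: emeasure_mixture)

lemma mixture_in_prob_on:
  assumes "\<rho> \<in> prob_on \<Theta>" "\<rho>' \<in> prob_on \<Theta>" "0 \<le> e" "e \<le> 1"
  shows "mixture e \<rho> \<rho>' \<in> prob_on \<Theta>"
proof -
  interpret p: prob_space \<rho> using assms by (simp add: prob_on_def)
  interpret q: prob_space \<rho>' using assms by (simp add: prob_on_def)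
  have s: "sets \<rho>' = sets \<rho>" using assms by (simp add: prob_on_def)
  then have "space \<rho>' = space \<rho>" by (rule sets_eq_imp_space_eq)
  then have "emeasure (mixture e \<rho> \<rho>') (space \<rho>) = ennreal e + ennreal (1 - e)"
    using p.emeasure_space_1 q.emeasure_space_1 s by (simp add: emeasure_mixture)
  also have "\<dots> = 1"
    using assms by (simp add: ennreal_plus[symmetric] del: ennreal_plus)
  finally have "prob_space (mixture e \<rho> \<rho>')"
    by (intro prob_spaceI) simp
  then show ?thesis using assms by (simp add: prob_on_def)
qed

section \<open>Kullback--Leibler divergence\<close>

text \<open>\<open>KL \<rho> \<rho>'\<close> is the divergence of \<open>\<rho>\<close> from \<open>\<rho>'\<close>. The library's \<open>KL_divergence\<close> takes its
  arguments in the opposite order and is real-valued. For probability measures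
  \<open>\<rho> \<lless> \<rho>'\<close> the negative part of the log-likelihood ratio is always \<open>\<rho>\<close>-integrable,
  so non-integrability means that the divergence is infinite.\<close>

definition KL :: "'a measure \<Rightarrow> 'a measure \<Rightarrow> ereal" where
  "KL \<rho> \<rho>' =
     (if absolutely_continuous \<rho>' \<rho> \<and> integrable \<rho> (entropy_density (exp 1) \<rho>' \<rho>)
      then ereal (KL_divergence (exp 1) \<rho>' \<rho>) else \<infinity>)"

section \<open>Functionals on probability measures\<close>

text \<open>A functional takes values in \<open>(-\<infinity>, \<infinity>]\<close>; only its values on \<open>prob_on \<Theta>\<close> matter.
  Lower semicontinuity refers to narrow convergence; as \<open>\<Theta>\<close> is separable metric, this
  topology is metrizable and sequences suffice.\<close>

definition lsc_functional ::
    "'a::euclidean_space set \<Rightarrow> ('a measure \<Rightarrow> ereal) \<Rightarrow> bool" where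
  "lsc_functional \<Theta> F \<longleftrightarrow>
     (\<forall>\<rho>\<in>prob_on \<Theta>. F \<rho> \<noteq> -\<infinity>) \<and>
     (\<forall>\<sigma> \<rho>. (\<forall>n. \<sigma> n \<in> prob_on \<Theta>) \<and> \<rho> \<in> prob_on \<Theta> \<and>
        (\<forall>f :: 'a \<Rightarrow> real. continuous_on \<Theta> f \<and> bounded (f ` \<Theta>) \<longrightarrow>
           (\<lambda>n. integral\<^sup>L (\<sigma> n) f) \<longlonglongrightarrow> integral\<^sup>L \<rho> f)
        \<longrightarrow> F \<rho> \<le> liminf (\<lambda>n. F (\<sigma> n)))"

definition regular_for ::
    "'a::euclidean_space set \<Rightarrow> ('a measure \<Rightarrow> ereal) \<Rightarrow> 'a measure \<Rightarrow> bool" where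
  "regular_for \<Theta> F \<rho> \<longleftrightarrow> \<rho> \<in> prob_on \<Theta> \<and>
     (\<forall>\<rho>'\<in>test_measures \<Theta>. \<forall>e\<in>{0<..<1}. F (mixture e \<rho> \<rho>') < \<infinity>)"

text \<open>\<open>g\<close> is a first variation of \<open>F\<close> at \<open>\<rho>\<close>. The derivative at \<open>0\<close> of
  \<open>F (\<rho> + e (\<rho>' - \<rho>))\<close> is one-sided, since \<open>\<rho> + e (\<rho>' - \<rho>)\<close> need not be a measure for \<open>e < 0\<close>.
  It presupposes that \<open>F \<rho>\<close> is finite; for \<open>0 < e < 1\<close> finiteness is regularity.
  Integrability with respect to \<open>\<rho>\<close> and all \<open>\<rho>'\<close> is integrability with respect to all
  \<open>\<bar>\<rho>' - \<rho>\<bar>\<close>, as a test measure splits into two disjointly supported ones.\<close>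

definition first_variation ::
    "'a::euclidean_space set \<Rightarrow> ('a measure \<Rightarrow> ereal) \<Rightarrow> 'a measure \<Rightarrow> ('a \<Rightarrow> real) \<Rightarrow> bool" where
  "first_variation \<Theta> F \<rho> g \<longleftrightarrow>
     regular_for \<Theta> F \<rho> \<and> \<bar>F \<rho>\<bar> \<noteq> \<infinity> \<and> integrable \<rho> g \<and>
     (\<forall>\<rho>'\<in>test_measures \<Theta>. integrable \<rho>' g \<and>
        ((\<lambda>e. real_of_ereal (F (mixture (1 - e) \<rho> \<rho>')))
           has_real_derivative (integral\<^sup>L \<rho>' g - integral\<^sup>L \<rho> g)) (at_right 0))"

text \<open>Lebesgue integral with values in \<open>[-\<infinity>, \<infinity>]\<close>, meaningful when at least one of the two
  parts is finite.\<close>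

definition ext_integral :: "'a measure \<Rightarrow> ('a \<Rightarrow> real) \<Rightarrow> ereal" where
  "ext_integral \<rho> g = enn2ereal (\<integral>\<^sup>+x. ennreal (g x) \<partial>\<rho>) - enn2ereal (\<integral>\<^sup>+x. ennreal (- g x) \<partial>\<rho>)"

text \<open>A first variation at \<open>\<rho>\<close> is \<open>\<rho>\<close>-integrable but not necessarily \<open>\<rho>'\<close>-integrable, so the
  integral of \<open>g\<close> against \<open>\<rho>' - \<rho>\<close> is an extended one. If the negative part of \<open>g\<close> has infinite
  \<open>\<rho>'\<close>-integral, the right-hand side below is \<open>-\<infinity>\<close> or an undefined \<open>\<infinity> - \<infinity>\<close> and the inequality
  says nothing; this case is excluded because \<open>-\<infinity> + \<infinity> = \<infinity>\<close> in type \<open>ereal\<close>. It does occur: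
  for \<open>F \<rho> = KL \<rho> \<pi>\<close> when \<open>KL \<rho>' \<pi>\<close> is finite but \<open>KL \<rho>' \<rho>\<close> is not.\<close>

definition rel_strongly_convex ::
    "'a::euclidean_space set \<Rightarrow> real \<Rightarrow> ('a measure \<Rightarrow> ereal) \<Rightarrow> bool" where
  "rel_strongly_convex \<Theta> l F \<longleftrightarrow>
     (\<forall>\<rho>\<in>prob_dens_on \<Theta>. \<forall>\<rho>'\<in>prob_dens_on \<Theta>. \<forall>g.
        regular_for \<Theta> F \<rho> \<and> regular_for \<Theta> F \<rho>' \<and> \<bar>F \<rho>\<bar> \<noteq> \<infinity> \<and> first_variation \<Theta> F \<rho> g \<and>
        (\<integral>\<^sup>+x. ennreal (- g x) \<partial>\<rho>') < \<infinity> \<longrightarrow>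
        F \<rho>' \<ge> F \<rho> + (ext_integral \<rho>' g - ereal (integral\<^sup>L \<rho> g)) + ereal l * KL \<rho>' \<rho>)"

definition global_minimizer ::
    "'a::euclidean_space set \<Rightarrow> ('a measure \<Rightarrow> ereal) \<Rightarrow> 'a measure \<Rightarrow> bool" where
  "global_minimizer \<Theta> F \<rho> \<longleftrightarrow> \<rho> \<in> prob_on \<Theta> \<and> (\<forall>\<rho>'\<in>prob_on \<Theta>. F \<rho> \<le> F \<rho>')"

section \<open>Inexact implicit KL proximal descent\<close>

text \<open>Up to additive constants, the first variation at \<open>\<rho>\<close> of \<open>F + KL(\<cdot>, \<rho>') / \<tau>\<close>, where \<open>g\<close> is a
  first variation of \<open>F\<close> at \<open>\<rho>\<close>, and \<open>r\<close>, \<open>r'\<close> are densities of \<open>\<rho>\<close>, \<open>\<rho>'\<close>.\<close>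

definition prox_variation ::
    "real \<Rightarrow> ('a \<Rightarrow> real) \<Rightarrow> ('a \<Rightarrow> real) \<Rightarrow> ('a \<Rightarrow> real) \<Rightarrow> 'a \<Rightarrow> real" where
  "prox_variation \<tau> g r r' x = g x + 1 / \<tau> * ln (r x / r' x)"

text \<open>Densities and first variations are determined only almost everywhere (and up to a
  constant), hence the choice of versions \<open>r\<close>, \<open>g\<close>. Positivity of the densities is what makes
  the log-ratio a real-valued function on \<open>\<Theta>\<close>.\<close>

definition inexact_prox_iterates ::
    "'a::euclidean_space set \<Rightarrow> ('a measure \<Rightarrow> ereal) \<Rightarrow> real \<Rightarrow> (nat \<Rightarrow> real) \<Rightarrow>
     (nat \<Rightarrow> 'a measure) \<Rightarrow> bool" where
  "inexact_prox_iterates \<Theta> F \<tau> tol \<rho> \<longleftrightarrow>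
     (\<forall>k. \<rho> k \<in> prob_dens_on \<Theta>) \<and> (\<forall>k\<ge>1. 0 \<le> tol k) \<and>
     (\<exists>r g. (\<forall>k. has_density \<Theta> (\<rho> k) (r k) \<and> (\<forall>x\<in>\<Theta>. 0 < r k x)) \<and>
        (\<forall>k\<ge>1. first_variation \<Theta> F (\<rho> k) (g k) \<and>
           (SUP (x, y)\<in>\<Theta> \<times> \<Theta>.
              ereal \<bar>prox_variation \<tau> (g k) (r k) (r (k - 1)) x
                   - prox_variation \<tau> (g k) (r k) (r (k - 1)) y\<bar>) \<le> ereal (tol k)))"

text \<open>Regularity of the minimizer \<open>\<rho>s\<close> is what allows strong convexity to be applied with
  \<open>\<rho>' = \<rho>s\<close>; it does not follow from the remaining conditions.\<close>

definition inexact_prox_setting ::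
    "real \<Rightarrow> real \<Rightarrow> 'a::euclidean_space set \<Rightarrow> ('a measure \<Rightarrow> ereal) \<Rightarrow> 'a measure \<Rightarrow>
     (nat \<Rightarrow> real) \<Rightarrow> (nat \<Rightarrow> 'a measure) \<Rightarrow> bool" where
  "inexact_prox_setting l \<tau> \<Theta> F \<rho>s tol \<rho> \<longleftrightarrow>
     \<Theta> \<in> sets borel \<and>
     lsc_functional \<Theta> F \<and>
     rel_strongly_convex \<Theta> l F \<and>
     global_minimizer \<Theta> F \<rho>s \<and> \<rho>s \<in> prob_dens_on \<Theta> \<and> regular_for \<Theta> F \<rho>s \<and>
     inexact_prox_iterates \<Theta> F \<tau> tol \<rho>"

end

theory Submission
  imports Defs "HOL-Real_Asymp.Real_Asymp"
begin

text \<open>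
  Write \<open>K\<^sub>k\<close> for the divergence of the minimizer \<open>\<rho>s\<close> from the \<open>k\<close>-th iterate, and let \<open>p\<close>,
  \<open>r\<^sub>k\<close> be densities of \<open>\<rho>s\<close> and \<open>\<rho>\<^sub>k\<close>. Everything rests on the one-step inequality
  \<open>(1 + l \<tau> / 2) K\<^sub>k \<le> K\<^sub>k\<^sub>-\<^sub>1 + (2 \<tau> / l) \<epsilon>\<^sub>k\<^sup>2\<close>  (\<open>KL_prox_step\<close>).

  Strong convexity at \<open>\<rho>\<^sub>k\<close>, tested at \<open>\<rho>s\<close> where \<open>F\<close> is smallest, gives
  \<open>\<integral> g d(\<rho>s - \<rho>\<^sub>k) + l K\<^sub>k \<le> 0\<close> for the first variation \<open>g\<close>. The proximal step says that
  \<open>g = \<eta> - ln (r\<^sub>k / r\<^sub>k\<^sub>-\<^sub>1) / \<tau>\<close> with \<open>\<eta>\<close> of oscillation at most \<open>\<epsilon>\<^sub>k\<close>. The logarithm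
  integrates to \<open>K\<^sub>k\<^sub>-\<^sub>1 - K\<^sub>k\<close> against \<open>\<rho>s\<close> and to the nonnegative divergence of \<open>\<rho>\<^sub>k\<close> from
  \<open>\<rho>\<^sub>k\<^sub>-\<^sub>1\<close> against \<open>\<rho>\<^sub>k\<close>, so \<open>(1 + l \<tau>) K\<^sub>k \<le> K\<^sub>k\<^sub>-\<^sub>1 - \<tau> \<integral> \<eta> d(\<rho>s - \<rho>\<^sub>k)\<close>. The error integral
  is at most \<open>\<epsilon>\<^sub>k \<integral> \<bar>p - r\<^sub>k\<bar>\<close>; a Pinsker inequality combined with Young's inequality bounds
  it by \<open>l K\<^sub>k / 2 + 2 \<epsilon>\<^sub>k\<^sup>2 / l\<close>, and half of the contraction absorbs the first term
  (\<open>rel_ent_descent\<close>). These manipulations need \<open>K\<^sub>k\<close> and the \<open>\<rho>s\<close>-integral of \<open>g\<close> to be finite.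
  Finiteness propagates from \<open>K\<^sub>k\<^sub>-\<^sub>1\<close>: this number controls the negative part of \<open>g\<close>, and
  then convexity itself bounds the positive part and \<open>K\<^sub>k\<close>.

  The rates are those of the linear recursion. For tolerances \<open>\<kappa> \<epsilon>\<^sup>k\<close> a multiple of
  \<open>\<epsilon>\<^bsup>2k\<^esup>\<close> is a particular solution, unless the two rates \<open>1 / \<epsilon>\<^sup>2\<close> and \<open>1 + l \<tau> / 2\<close>
  coincide. For tolerances \<open>\<epsilon> k\<^bsup>-\<alpha>\<^esup>\<close> the exponentially decaying weights of past errors
  dominate any polynomial, so the latest error determines the order. If \<open>K\<^sub>0\<close> is infinite, both
  bounds are trivial.
\<close>

section \<open>A pointwise Pinsker inequality\<close>

text \<open>The squared Hellinger distance is at most the divergence, already at the level of integrands: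
  with \<open>s = sqrt t\<close> the difference of the two sides is \<open>2 s (s ln s - s + 1)\<close>.\<close>

lemma hellinger_le_entropy_integrand:
  fixes t :: real
  assumes "0 \<le> t"
  shows "(sqrt t - 1)\<^sup>2 \<le> t * ln t - t + 1"
proof (cases "t = 0")
  case False
  define s where "s = sqrt t"
  have s: "0 < s" and t: "t = s\<^sup>2"
    using assms False by (auto simp: s_def)
  have "ln (1 / s) \<le> 1 / s - 1"
    using s by (intro ln_le_minus_one) auto
  then have "s * (1 - 1 / s) \<le> s * ln s"
    using s by (intro mult_left_mono) (auto simp: ln_div)
  then have "2 * s * (s - 1) \<le> 2 * s * (s * ln s)"
    using s by (intro mult_left_mono) (auto simp: algebra_simps)
  moreover have "ln t = 2 * ln s"
    using s by (simp add: t ln_realpow)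
  ultimately show ?thesis
    unfolding s_def[symmetric] by (simp add: t power2_eq_square algebra_simps)
qed auto

text \<open>Integrated against probability densities this reads \<open>e \<integral> \<bar>p - q\<bar> \<le> a KL + e\<^sup>2 / a\<close>,
  which is Pinsker's inequality after optimizing over \<open>a\<close> (with a non-optimal constant). The usual
  Cauchy--Schwarz step for integrals becomes \<open>\<bar>t - 1\<bar> = \<bar>sqrt t - 1\<bar> (sqrt t + 1)\<close> and Young's
  inequality for numbers, where \<open>t = p / q\<close>.\<close>

lemma entropy_integrand_young:
  fixes p q a e :: real
  assumes "0 \<le> p" "0 < q" "0 < a"
  shows "e * \<bar>p - q\<bar> \<le> a * (p * ln (p / q) - p + q) + e\<^sup>2 * (p + q) / (2 * a)"
proof -
  define t where "t = p / q"
  define D where "D = t * ln t - t + 1"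
  have t: "0 \<le> t" and p: "p = q * t"
    using assms by (auto simp: t_def)
  have "(t - 1)\<^sup>2 = (sqrt t - 1)\<^sup>2 * (sqrt t + 1)\<^sup>2"
    using t by (simp add: power_mult_distrib[symmetric] algebra_simps)
  also have "\<dots> \<le> D * (2 * (t + 1))"
  proof (rule mult_mono)
    have "0 \<le> (sqrt t - 1)\<^sup>2"
      by simp
    then show "(sqrt t + 1)\<^sup>2 \<le> 2 * (t + 1)"
      using t by (simp add: power2_sum power2_diff)
    show "(sqrt t - 1)\<^sup>2 \<le> D"
      unfolding D_def by (rule hellinger_le_entropy_integrand[OF t])
    then show "0 \<le> D"
      by (meson order_trans zero_le_power2)
  qed simp
  finally have sq: "(t - 1)\<^sup>2 \<le> 2 * (t + 1) * D"
    by (simp add: algebra_simps)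
  \<comment> \<open>completing the square in \<open>a \<bar>t - 1\<bar>\<close> and \<open>e (t + 1)\<close>\<close>
  have "2 * (a * \<bar>t - 1\<bar>) * (e * (t + 1)) \<le> (a * \<bar>t - 1\<bar>)\<^sup>2 + (e * (t + 1))\<^sup>2"
    by (rule sum_squares_bound)
  then have "2 * a * (t + 1) * (e * \<bar>t - 1\<bar>) \<le> a\<^sup>2 * (t - 1)\<^sup>2 + e\<^sup>2 * (t + 1)\<^sup>2"
    unfolding power_mult_distrib power2_abs by (simp only: mult_ac)
  also have "\<dots> \<le> a\<^sup>2 * (2 * (t + 1) * D) + e\<^sup>2 * (t + 1)\<^sup>2"
    using sq by (intro add_right_mono mult_left_mono) auto
  also have "\<dots> = 2 * a * (t + 1) * (a * D + e\<^sup>2 * (t + 1) / (2 * a))"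
    using assms by (simp add: field_simps power2_eq_square)
  finally have "e * \<bar>t - 1\<bar> \<le> a * D + e\<^sup>2 * (t + 1) / (2 * a)"
    using assms t by (simp add: mult_le_cancel_left)
  then have "q * (e * \<bar>t - 1\<bar>) \<le> q * (a * D + e\<^sup>2 * (t + 1) / (2 * a))"
    using assms by (intro mult_left_mono) auto
  moreover have "q * \<bar>t - 1\<bar> = \<bar>p - q\<bar>"
    using assms abs_mult[of q "t - 1"] by (simp add: p right_diff_distrib)
  moreover have "q * (a * D + e\<^sup>2 * (t + 1) / (2 * a))
      = a * (p * ln (p / q) - p + q) + e\<^sup>2 * (p + q) / (2 * a)"
    using assms by (simp add: D_def t_def field_simps)
  ultimately show ?thesis
    by (metis mult.left_commute)
qed

lemma gibbs_integrand:
  fixes p q :: real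
  assumes "0 \<le> p" "0 < q"
  shows "p - q \<le> p * ln (p / q)"
  using entropy_integrand_young[OF assms, of 1 0] by simp

text \<open>Where \<open>p = 0\<close> all terms vanish because of the factor \<open>p\<close>, whatever value \<open>ln 0\<close> has.\<close>

lemma mult_ln_ratio_chain:
  fixes p q q0 :: real
  assumes "0 \<le> p" "0 < q" "0 < q0"
  shows "p * ln (q / q0) = p * ln (p / q0) - p * ln (p / q)"
  using assms by (cases "p = 0") (auto simp: ln_div right_diff_distrib)

section \<open>Relative entropy of densities\<close>

text \<open>A Bochner integral, zero when the integrand is not integrable: it represents the divergence
  only under integrability.\<close>

definition rel_ent :: "'a measure \<Rightarrow> ('a \<Rightarrow> real) \<Rightarrow> ('a \<Rightarrow> real) \<Rightarrow> real" where
  "rel_ent M p q = (\<integral>x. p x * ln (p x / q x) \<partial>M)"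

definition prob_dens :: "'a measure \<Rightarrow> ('a \<Rightarrow> real) \<Rightarrow> bool" where
  "prob_dens M p \<longleftrightarrow> (\<forall>x\<in>space M. 0 \<le> p x) \<and> integrable M p \<and> (\<integral>x. p x \<partial>M) = 1"

lemma rel_ent_nonneg:
  assumes p: "prob_dens M p" and q: "prob_dens M q" and pos: "\<And>x. x \<in> space M \<Longrightarrow> 0 < q x"
    and int: "integrable M (\<lambda>x. p x * ln (p x / q x))"
  shows "0 \<le> rel_ent M p q"
proof -
  have "(\<integral>x. p x - q x \<partial>M) \<le> rel_ent M p q"
    unfolding rel_ent_def using p q pos int
    by (intro integral_mono gibbs_integrand) (auto simp: prob_dens_def)
  then show ?thesis
    using p q by (simp add: prob_dens_def)
qed

lemma prob_dens_of_prob_space: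
  assumes "prob_space (density M (\<lambda>x. ennreal (p x)))" "p \<in> borel_measurable M"
    "\<forall>x\<in>space M. 0 \<le> p x"
  shows "prob_dens M p"
proof -
  have "emeasure (density M (\<lambda>x. ennreal (p x))) (space M) = 1"
    using prob_space.emeasure_space_1[OF assms(1)] by simp
  then have "(\<integral>\<^sup>+x. ennreal (p x) \<partial>M) = 1"
    using assms(2) by (simp add: emeasure_density cong: nn_integral_cong)
  moreover have "AE x in M. 0 \<le> p x"
    using assms(3) by auto
  ultimately show ?thesis
    using assms(2,3) nn_integral_eq_integrable[of p M 1] by (auto simp: prob_dens_def)
qed

text \<open>Since \<open>q > 0\<close>, the first measure has density \<open>p / q\<close> with respect to the second; the
  Radon--Nikodym derivative in the definition of \<open>KL\<close> agrees with it almost everywhere.\<close>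

lemma KL_density:
  assumes P: "prob_space (density M (\<lambda>x. ennreal (p x)))"
    and Q: "prob_space (density M (\<lambda>x. ennreal (q x)))"
    and [measurable]: "p \<in> borel_measurable M" "q \<in> borel_measurable M"
    and p0: "\<forall>x\<in>space M. 0 \<le> p x" and q0: "\<forall>x\<in>space M. 0 < q x"
  shows "KL (density M (\<lambda>x. ennreal (p x))) (density M (\<lambda>x. ennreal (q x))) =
    (if integrable M (\<lambda>x. p x * ln (p x / q x)) then ereal (rel_ent M p q) else \<infinity>)"
proof -
  let ?P = "density M (\<lambda>x. ennreal (p x))" and ?Q = "density M (\<lambda>x. ennreal (q x))"
  interpret Q: prob_space ?Q by (rule Q)
  have eq: "density ?Q (\<lambda>x. ennreal (p x / q x)) = ?P"
    using p0 q0
    by (subst density_density_eq)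
       (auto intro!: density_cong simp: ennreal_mult[symmetric] less_imp_le less_imp_neq[symmetric])
  have ac: "absolutely_continuous ?Q ?P"
    unfolding eq[symmetric] by (rule absolutely_continuousI_density) simp
  have rn: "AE x in ?Q. ennreal (p x / q x) = RN_deriv ?Q ?P x"
    by (rule Q.RN_deriv_unique[OF _ eq]) simp
  then have "AE x in ?P. ennreal (p x / q x) = RN_deriv ?Q ?P x"
    by (rule absolutely_continuous_AE[OF _ ac, rotated]) simp
  moreover have "AE x in ?P. 0 \<le> p x / q x"
    using p0 q0 by (intro AE_I2) (auto simp: less_imp_le)
  ultimately have ed: "AE x in ?P. entropy_density (exp 1) ?Q ?P x = ln (p x / q x)"
  proof eventually_elim
    case (elim x)
    then show ?case
      unfolding entropy_density_def log_ln[symmetric] comp_apply elim(1)[symmetric]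
      using elim(2) by simp
  qed
  have [measurable]: "entropy_density (exp 1) ?Q ?P \<in> borel_measurable M"
    using measurable_entropy_density[of "exp 1" ?Q ?P] by simp
  have "integrable ?P (entropy_density (exp 1) ?Q ?P) \<longleftrightarrow> integrable ?P (\<lambda>x. ln (p x / q x))"
    by (rule integrable_cong_AE[OF _ _ ed]) auto
  also have "\<dots> \<longleftrightarrow> integrable M (\<lambda>x. p x * ln (p x / q x))"
    using p0 by (subst integrable_density) auto
  finally have i: "integrable ?P (entropy_density (exp 1) ?Q ?P)
      \<longleftrightarrow> integrable M (\<lambda>x. p x * ln (p x / q x))" .
  have "KL_divergence (exp 1) ?Q ?P = (\<integral>x. ln (p x / q x) \<partial>?P)"
    unfolding KL_divergence_def by (rule integral_cong_AE[OF _ _ ed]) auto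
  also have "\<dots> = rel_ent M p q"
    unfolding rel_ent_def using p0 by (subst integral_density) auto
  finally show ?thesis
    by (simp add: KL_def ac i)
qed

lemma integrable_prob_dens_mult:
  assumes f: "prob_dens M f" and [measurable]: "h \<in> borel_measurable M"
    and h: "\<And>x. x \<in> space M \<Longrightarrow> \<bar>h x\<bar> \<le> e"
  shows "integrable M (\<lambda>x. f x * h x)"
proof (rule Bochner_Integration.integrable_bound[of M "\<lambda>x. e * f x"])
  show "AE x in M. norm (f x * h x) \<le> norm (e * f x)"
  proof (rule AE_I2)
    fix x assume x: "x \<in> space M"
    then have "\<bar>f x\<bar> * \<bar>h x\<bar> \<le> \<bar>f x\<bar> * \<bar>e\<bar>"
      using h[OF x] by (intro mult_left_mono) auto
    then show "norm (f x * h x) \<le> norm (e * f x)"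
      by (simp add: abs_mult mult.commute)
  qed
qed (use f in \<open>auto simp: prob_dens_def\<close>)

text \<open>The cost of an error: the price \<open>a KL\<close> is to be absorbed by strong convexity, which
  leaves a quadratic error in \<open>e\<close>.\<close>

lemma integral_osc_young:
  assumes p: "prob_dens M p" and q: "prob_dens M q" and pos: "\<And>x. x \<in> space M \<Longrightarrow> 0 < q x"
    and int: "integrable M (\<lambda>x. p x * ln (p x / q x))"
    and [measurable]: "h \<in> borel_measurable M"
    and h: "\<And>x. x \<in> space M \<Longrightarrow> \<bar>h x\<bar> \<le> e" and a: "0 < a"
  shows "(\<integral>x. q x * h x \<partial>M) - (\<integral>x. p x * h x \<partial>M) \<le> a * rel_ent M p q + e\<^sup>2 / a"
proof -
  note bdd = integrable_prob_dens_mult[OF _ \<open>h \<in> borel_measurable M\<close> h]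
  let ?R = "\<lambda>x. a * (p x * ln (p x / q x) - p x + q x) + e\<^sup>2 / (2 * a) * (p x + q x)"
  have "(\<integral>x. q x * h x - p x * h x \<partial>M) \<le> (\<integral>x. ?R x \<partial>M)"
  proof (rule integral_mono)
    fix x assume x: "x \<in> space M"
    have "q x * h x - p x * h x = (q x - p x) * h x"
      by (simp add: algebra_simps)
    also have "\<dots> \<le> \<bar>q x - p x\<bar> * \<bar>h x\<bar>"
      by (metis abs_ge_self abs_mult)
    also have "\<dots> \<le> \<bar>q x - p x\<bar> * e"
      using h[OF x] by (intro mult_left_mono) auto
    also have "\<dots> = e * \<bar>p x - q x\<bar>"
      by (simp add: abs_minus_commute)
    also have "\<dots> \<le> ?R x"
      using entropy_integrand_young[of "p x" "q x" a e] x p pos a by (simp add: prob_dens_def)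
    finally show "q x * h x - p x * h x \<le> ?R x" .
  qed (use p q int bdd in \<open>auto simp: prob_dens_def\<close>)
  also have "\<dots> = a * rel_ent M p q + e\<^sup>2 / (2 * a) * 2"
    using p q int by (simp add: prob_dens_def rel_ent_def)
  also have "\<dots> = a * rel_ent M p q + e\<^sup>2 / a"
    by simp
  finally show ?thesis
    using p q bdd by simp
qed


section \<open>One inexact proximal step\<close>

text \<open>The choice \<open>a = l / 2\<close> in the error estimate spends half of the term \<open>l KL\<close> given by
  strong convexity. Subtracting the value \<open>c\<close> of the variation at one point turns the oscillation bound
  into a sup-norm bound; \<open>c\<close> cancels because \<open>p\<close> and \<open>q\<close> have the same mass.\<close>

lemma rel_ent_descent:
  fixes p q q0 g :: "'a \<Rightarrow> real"
  assumes p: "prob_dens M p" and q: "prob_dens M q" and q0: "prob_dens M q0"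
    and pos: "\<And>x. x \<in> space M \<Longrightarrow> 0 < q x" and pos0: "\<And>x. x \<in> space M \<Longrightarrow> 0 < q0 x"
    and int: "integrable M (\<lambda>x. p x * ln (p x / q x))"
    and int0: "integrable M (\<lambda>x. p x * ln (p x / q0 x))"
    and [measurable]: "g \<in> borel_measurable M"
    and pg: "integrable M (\<lambda>x. p x * g x)" and qg: "integrable M (\<lambda>x. q x * g x)"
    and osc: "\<And>x y. x \<in> space M \<Longrightarrow> y \<in> space M \<Longrightarrow>
       \<bar>prox_variation \<tau> g q q0 x - prox_variation \<tau> g q q0 y\<bar> \<le> e"
    and conv: "(\<integral>x. p x * g x \<partial>M) - (\<integral>x. q x * g x \<partial>M) + l * rel_ent M p q \<le> 0"
    and l: "0 < l" and \<tau>: "0 < \<tau>"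
  shows "(1 + l * \<tau> / 2) * rel_ent M p q \<le> rel_ent M p q0 + 2 * \<tau> / l * e\<^sup>2"
proof -
  have [measurable]: "q \<in> borel_measurable M" "q0 \<in> borel_measurable M"
    using q q0 by (auto simp: prob_dens_def)
  have "space M \<noteq> {}"
    using p Bochner_Integration.integral_empty[of M p] by (auto simp: prob_dens_def)
  then obtain x0 where x0: "x0 \<in> space M"
    by auto
  define c where "c = prox_variation \<tau> g q q0 x0"
  define h where "h = (\<lambda>x. prox_variation \<tau> g q q0 x - c)"
  define L where "L = (\<lambda>x. ln (q x / q0 x))"
  have [measurable]: "h \<in> borel_measurable M"
    by (simp add: h_def prox_variation_def)
  have h_le: "\<bar>h x\<bar> \<le> e" if "x \<in> space M" for x
    using osc[OF that x0] by (simp add: h_def c_def)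
  have g_eq: "\<tau> * g x = \<tau> * h x + \<tau> * c - L x" for x
    using \<tau> by (simp add: h_def prox_variation_def L_def field_simps)
  note bdd = integrable_prob_dens_mult[OF _ \<open>h \<in> borel_measurable M\<close> h_le]
  \<comment> \<open>Against \<open>p\<close>, the logarithm telescopes into a difference of divergences.\<close>
  have pL: "p x * L x = p x * ln (p x / q0 x) - p x * ln (p x / q x)" if "x \<in> space M" for x
    using that p pos[OF that] pos0[OF that]
    unfolding L_def by (intro mult_ln_ratio_chain) (auto simp: prob_dens_def)
  have qL: "q x * L x = \<tau> * (q x * h x) + \<tau> * c * q x - \<tau> * (q x * g x)" for x
  proof -
    have "q x * L x = q x * (\<tau> * h x + \<tau> * c - \<tau> * g x)"
      by (simp add: g_eq)
    then show ?thesis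
      by (simp add: algebra_simps)
  qed
  have int_qL: "integrable M (\<lambda>x. q x * L x)"
    unfolding qL using q qg bdd[OF q] by (auto simp: prob_dens_def)
  \<comment> \<open>Against \<open>q\<close> it gives the divergence between successive iterates, of which only the sign
    is kept.\<close>
  have "0 \<le> rel_ent M q q0"
    using int_qL by (intro rel_ent_nonneg[OF q q0 pos0]) (simp_all add: L_def)
  then have "0 \<le> (\<integral>x. \<tau> * (q x * h x) + \<tau> * c * q x - \<tau> * (q x * g x) \<partial>M)"
    unfolding qL[symmetric] by (simp add: rel_ent_def L_def)
  also have "\<dots> = \<tau> * (\<integral>x. q x * h x \<partial>M) + \<tau> * c - \<tau> * (\<integral>x. q x * g x \<partial>M)"
    using q qg bdd[OF q] by (simp add: prob_dens_def)
  finally have 1: "\<tau> * (\<integral>x. q x * g x \<partial>M) \<le> \<tau> * (\<integral>x. q x * h x \<partial>M) + \<tau> * c"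
    by simp
  have "\<tau> * (\<integral>x. p x * g x \<partial>M) = (\<integral>x. \<tau> * (p x * g x) \<partial>M)"
    by simp
  also have "\<dots> = (\<integral>x. \<tau> * (p x * h x) + \<tau> * c * p x
      - (p x * ln (p x / q0 x) - p x * ln (p x / q x)) \<partial>M)"
  proof (rule Bochner_Integration.integral_cong[OF refl])
    fix x assume x: "x \<in> space M"
    show "\<tau> * (p x * g x) = \<tau> * (p x * h x) + \<tau> * c * p x
      - (p x * ln (p x / q0 x) - p x * ln (p x / q x))"
      unfolding pL[OF x, symmetric] mult.left_commute[of \<tau>] g_eq by (simp add: algebra_simps)
  qed
  also have "\<dots> = \<tau> * (\<integral>x. p x * h x \<partial>M) + \<tau> * c - (rel_ent M p q0 - rel_ent M p q)"
    using p bdd[OF p] int int0 by (simp add: prob_dens_def rel_ent_def)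
  finally have 2: "\<tau> * (\<integral>x. p x * g x \<partial>M)
      = \<tau> * (\<integral>x. p x * h x \<partial>M) + \<tau> * c - (rel_ent M p q0 - rel_ent M p q)" .
  have "(\<integral>x. q x * h x \<partial>M) - (\<integral>x. p x * h x \<partial>M) \<le> l / 2 * rel_ent M p q + e\<^sup>2 / (l / 2)"
    using l h_le by (intro integral_osc_young[OF p q pos int]) auto
  then have "\<tau> * ((\<integral>x. q x * h x \<partial>M) - (\<integral>x. p x * h x \<partial>M))
      \<le> \<tau> * (l / 2 * rel_ent M p q + e\<^sup>2 / (l / 2))"
    using \<tau> by (intro mult_left_mono) auto
  moreover have "\<tau> * ((\<integral>x. p x * g x \<partial>M) - (\<integral>x. q x * g x \<partial>M) + l * rel_ent M p q) \<le> 0"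
    using conv \<tau> by (simp add: mult_le_0_iff)
  ultimately show ?thesis
    using 1 2 by (simp add: algebra_simps)
qed

text \<open>Strong convexity may only be tested at the minimizer if the negative part of the first variation
  has a finite integral there. Up to a bounded function, \<open>- \<tau> g\<close> is
  \<open>ln (q / q0) = ln (p / q0) - ln (p / q)\<close>. The first part is integrable by assumption; the second,
  whose integral may still turn out to be infinite, is bounded on the relevant side by
  \<open>- p ln (p / q) \<le> q - p\<close>.\<close>

lemma nn_integral_neg_part_finite:
  fixes p q q0 g :: "'a \<Rightarrow> real"
  assumes p: "prob_dens M p" and q: "prob_dens M q"
    and pos: "\<And>x. x \<in> space M \<Longrightarrow> 0 < q x" and pos0: "\<And>x. x \<in> space M \<Longrightarrow> 0 < q0 x"
    and int0: "integrable M (\<lambda>x. p x * ln (p x / q0 x))"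
    and bdd: "\<And>x. x \<in> space M \<Longrightarrow> \<bar>prox_variation \<tau> g q q0 x\<bar> \<le> b" and \<tau>: "0 < \<tau>"
  shows "(\<integral>\<^sup>+x. ennreal (p x * - g x) \<partial>M) < \<infinity>"
proof -
  let ?B = "\<lambda>x. b * p x + 1 / \<tau> * (\<bar>p x * ln (p x / q0 x)\<bar> + q x)"
  have "(\<integral>\<^sup>+x. ennreal (p x * - g x) \<partial>M) \<le> (\<integral>\<^sup>+x. ennreal (?B x) \<partial>M)"
  proof (intro nn_integral_mono ennreal_leI)
    fix x assume x: "x \<in> space M"
    have p0: "0 \<le> p x"
      using p x by (simp add: prob_dens_def)
    have "p x * ln (q x / q0 x) = p x * ln (p x / q0 x) - p x * ln (p x / q x)"
      by (rule mult_ln_ratio_chain[OF p0 pos[OF x] pos0[OF x]])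
    moreover have "p x - q x \<le> p x * ln (p x / q x)"
      by (rule gibbs_integrand[OF p0 pos[OF x]])
    ultimately have "p x * ln (q x / q0 x) \<le> \<bar>p x * ln (p x / q0 x)\<bar> + q x"
      using p0 by linarith
    then have "1 / \<tau> * (p x * ln (q x / q0 x)) \<le> 1 / \<tau> * (\<bar>p x * ln (p x / q0 x)\<bar> + q x)"
      using \<tau> by (intro mult_left_mono) auto
    moreover have "p x * - prox_variation \<tau> g q q0 x \<le> p x * b"
      using bdd[OF x] p0 by (intro mult_left_mono) auto
    moreover have "p x * - g x = p x * - prox_variation \<tau> g q q0 x + 1 / \<tau> * (p x * ln (q x / q0 x))"
      by (simp add: prox_variation_def algebra_simps)
    ultimately show "p x * - g x \<le> ?B x"
      by (simp add: mult.commute)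
  qed
  also have "\<dots> < \<infinity>"
  proof -
    have "integrable M ?B"
      using p q int0 by (auto simp: prob_dens_def)
    then show ?thesis
      by (simp add: real_integrable_def less_top)
  qed
  finally show ?thesis .
qed

text \<open>Arithmetic of extended reals: \<open>Fk\<close> cancels, and then the two nonnegative quantities \<open>P\<close> and
  \<open>K\<close>, whose combination is bounded above, must both be finite. \<open>P\<close> and \<open>N\<close> stand for the
  integrals of the two parts of the first variation against the minimizer.\<close>

lemma convexity_at_minimizer:
  fixes Fs Fk P N K :: ereal and G l :: real
  assumes "Fk + ((P - N) - ereal G) + ereal l * K \<le> Fs" "Fs \<le> Fk" "\<bar>Fk\<bar> \<noteq> \<infinity>"
    and "0 \<le> P" "0 \<le> N" "N < \<infinity>" "0 \<le> K" "0 < l"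
  shows "P < \<infinity>" "K < \<infinity>" "real_of_ereal P - real_of_ereal N - G + l * real_of_ereal K \<le> 0"
proof -
  obtain a where a: "Fk = ereal a"
    using assms(3) by (cases Fk) auto
  obtain n where n: "N = ereal n"
    using assms(5,6) by (cases N) auto
  have le: "ereal a + ((P - ereal n) - ereal G) + ereal l * K \<le> ereal a"
    using assms(1,2) by (simp add: a n)
  have K': "0 \<le> ereal l * K"
    using assms(7,8) by simp
  have "P \<noteq> \<infinity>"
    using le K' by auto
  then obtain u where u: "P = ereal u"
    using assms(4) by (cases P) auto
  have "K \<noteq> \<infinity>"
    using le assms(8) by (auto simp: u)
  then obtain v where v: "K = ereal v"
    using assms(7) by (cases K) auto
  show "P < \<infinity>" "K < \<infinity>" "real_of_ereal P - real_of_ereal N - G + l * real_of_ereal K \<le> 0"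
    using le by (simp_all add: u v n)
qed

lemma KL_prox_step:
  assumes S: "inexact_prox_setting l \<tau> \<Theta> F \<rho>s tol \<rho>" and l: "0 < l" and \<tau>: "0 < \<tau>"
    and k: "1 \<le> k" and fin: "KL \<rho>s (\<rho> (k - 1)) < \<infinity>"
  shows "0 \<le> KL \<rho>s (\<rho> (k - 1))" "0 \<le> KL \<rho>s (\<rho> k)" "KL \<rho>s (\<rho> k) < \<infinity>"
    "(1 + l * \<tau> / 2) * real_of_ereal (KL \<rho>s (\<rho> k))
       \<le> real_of_ereal (KL \<rho>s (\<rho> (k - 1))) + 2 * \<tau> / l * (tol k)\<^sup>2"
proof -
  define M where "M = lebesgue_on_set \<Theta>"
  have sp: "space M = \<Theta>"
    by (simp add: M_def lebesgue_on_set_def space_restrict_space)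
  from S obtain r g where r: "\<And>k. has_density \<Theta> (\<rho> k) (r k)" and r_pos: "\<And>k x. x \<in> \<Theta> \<Longrightarrow> 0 < r k x"
    and fv: "first_variation \<Theta> F (\<rho> k) (g k)"
    and sup: "(SUP (x, y)\<in>\<Theta> \<times> \<Theta>. ereal \<bar>prox_variation \<tau> (g k) (r k) (r (k - 1)) x
                   - prox_variation \<tau> (g k) (r k) (r (k - 1)) y\<bar>) \<le> ereal (tol k)"
    using k unfolding inexact_prox_setting_def inexact_prox_iterates_def by blast
  from S obtain p where p: "has_density \<Theta> \<rho>s p"
    unfolding inexact_prox_setting_def prob_dens_on_def by blast
  have \<rho>s: "\<rho>s = density M (\<lambda>x. ennreal (p x))" and [measurable]: "p \<in> borel_measurable M"
    and p0: "\<forall>x\<in>space M. 0 \<le> p x"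
    using p by (auto simp: has_density_def M_def[symmetric] sp)
  have \<rho>: "\<rho> j = density M (\<lambda>x. ennreal (r j x))" and [measurable]: "r j \<in> borel_measurable M" for j
    using r[of j] by (auto simp: has_density_def M_def[symmetric])
  have r_pos': "\<And>j x. x \<in> space M \<Longrightarrow> 0 < r j x"
    using r_pos sp by auto
  have ps: "prob_space \<rho>s" and pr: "prob_space (\<rho> j)" for j
    using S unfolding inexact_prox_setting_def inexact_prox_iterates_def prob_dens_on_def prob_on_def
    by auto
  have dp: "prob_dens M p"
    using ps p0 unfolding \<rho>s by (intro prob_dens_of_prob_space) auto
  have dr: "prob_dens M (r j)" for j
    using pr[of j] r_pos'[of _ j] unfolding \<rho> by (intro prob_dens_of_prob_space) (auto simp: less_imp_le)
  have KL_eq: "KL \<rho>s (\<rho> j) = (if integrable M (\<lambda>x. p x * ln (p x / r j x))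
      then ereal (rel_ent M p (r j)) else \<infinity>)" for j
    unfolding \<rho>s \<rho> using ps pr[of j] p0 r_pos' by (intro KL_density) (auto simp: \<rho>s \<rho>)
  have KL_nonneg: "0 \<le> KL \<rho>s (\<rho> j)" for j
    using rel_ent_nonneg[OF dp dr r_pos'] by (auto simp: KL_eq)
  show "0 \<le> KL \<rho>s (\<rho> (k - 1))" "0 \<le> KL \<rho>s (\<rho> k)"
    by (rule KL_nonneg)+
  have int0: "integrable M (\<lambda>x. p x * ln (p x / r (k - 1) x))"
    using fin by (auto simp: KL_eq split: if_splits)
  have osc: "\<bar>prox_variation \<tau> (g k) (r k) (r (k - 1)) x - prox_variation \<tau> (g k) (r k) (r (k - 1)) y\<bar>
      \<le> tol k" if "x \<in> space M" "y \<in> space M" for x y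
    using SUP_upper[of "(x, y)" "\<Theta> \<times> \<Theta>" "\<lambda>(x, y). ereal \<bar>prox_variation \<tau> (g k) (r k) (r (k - 1)) x
                   - prox_variation \<tau> (g k) (r k) (r (k - 1)) y\<bar>"] sup that sp
    by (auto dest: order_trans)
  have "space M \<noteq> {}"
    using prob_space.not_empty[OF ps] by (simp add: \<rho>s)
  then obtain x0 where x0: "x0 \<in> space M"
    by auto
  have int_g: "integrable (\<rho> k) (g k)" and F_fin: "\<bar>F (\<rho> k)\<bar> \<noteq> \<infinity>" and reg: "regular_for \<Theta> F (\<rho> k)"
    using fv by (auto simp: first_variation_def)
  have [measurable]: "g k \<in> borel_measurable M"
    using borel_measurable_integrable[OF int_g] by (simp add: \<rho>)
  have qg: "integrable M (\<lambda>x. r k x * g k x)"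
    using int_g r_pos' unfolding \<rho> by (subst (asm) integrable_density) (auto simp: less_imp_le)
  have Gq: "integral\<^sup>L (\<rho> k) (g k) = (\<integral>x. r k x * g k x \<partial>M)"
    unfolding \<rho> using r_pos' by (subst integral_density) (auto simp: less_imp_le)
  have nn: "(\<integral>\<^sup>+x. ennreal (f x) \<partial>\<rho>s) = (\<integral>\<^sup>+x. ennreal (p x * f x) \<partial>M)"
    if [measurable]: "f \<in> borel_measurable M" for f
    unfolding \<rho>s using p0
    by (subst nn_integral_density) (auto intro!: nn_integral_cong simp: ennreal_mult')
  have N_fin: "(\<integral>\<^sup>+x. ennreal (- g k x) \<partial>\<rho>s) < \<infinity>"
  proof -
    have "(\<integral>\<^sup>+x. ennreal (p x * - g k x) \<partial>M) < \<infinity>"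
    proof (rule nn_integral_neg_part_finite[OF dp dr r_pos' r_pos' int0 _ \<tau>])
      show "\<bar>prox_variation \<tau> (g k) (r k) (r (k - 1)) x\<bar>
          \<le> \<bar>prox_variation \<tau> (g k) (r k) (r (k - 1)) x0\<bar> + tol k" if "x \<in> space M" for x
        using osc[OF that x0] by linarith
    qed
    then show ?thesis
      by (subst nn) auto
  qed
  have dens: "\<rho> k \<in> prob_dens_on \<Theta>" "\<rho>s \<in> prob_dens_on \<Theta>" and regs: "regular_for \<Theta> F \<rho>s"
    and sc: "rel_strongly_convex \<Theta> l F" and min: "F \<rho>s \<le> F (\<rho> k)"
    using S unfolding inexact_prox_setting_def inexact_prox_iterates_def global_minimizer_def prob_dens_on_def
    by auto
  let ?P = "enn2ereal (\<integral>\<^sup>+x. ennreal (g k x) \<partial>\<rho>s)" and ?N = "enn2ereal (\<integral>\<^sup>+x. ennreal (- g k x) \<partial>\<rho>s)"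
  have "F (\<rho> k) + (?P - ?N - ereal (integral\<^sup>L (\<rho> k) (g k))) + ereal l * KL \<rho>s (\<rho> k) \<le> F \<rho>s"
    using sc[unfolded rel_strongly_convex_def, rule_format, OF dens, of "g k"] regs reg F_fin fv N_fin
    by (simp add: ext_integral_def)
  note conv = convexity_at_minimizer[OF this min F_fin enn2ereal_nonneg enn2ereal_nonneg _ KL_nonneg l]
  have N': "?N < \<infinity>"
    using N_fin by (simp add: less_top)
  have "?P < \<infinity>"
    using conv(1)[OF N'] .
  then have P_fin: "(\<integral>\<^sup>+x. ennreal (g k x) \<partial>\<rho>s) < \<infinity>"
    by (simp add: less_top)
  show K_fin: "KL \<rho>s (\<rho> k) < \<infinity>"
    using conv(2)[OF N'] .
  then have int: "integrable M (\<lambda>x. p x * ln (p x / r k x))"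
    by (auto simp: KL_eq split: if_splits)
  have gs: "integrable \<rho>s (g k)"
    using P_fin N_fin by (subst real_integrable_def) (auto simp: \<rho>s)
  have pg: "integrable M (\<lambda>x. p x * g k x)"
    using gs p0 unfolding \<rho>s by (subst (asm) integrable_density) auto
  have "real_of_ereal ?P - real_of_ereal ?N = integral\<^sup>L \<rho>s (g k)"
    unfolding real_lebesgue_integral_def[OF gs] enn2real_def o_def ..
  also have "\<dots> = (\<integral>x. p x * g k x \<partial>M)"
    unfolding \<rho>s using p0 by (subst integral_density) auto
  finally have "(\<integral>x. p x * g k x \<partial>M) - (\<integral>x. r k x * g k x \<partial>M) + l * rel_ent M p (r k) \<le> 0"
    using conv(3)[OF N'] by (simp add: Gq KL_eq int)
  from rel_ent_descent[OF dp dr dr r_pos' r_pos' int int0 _ pg qg osc this l \<tau>]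
  show "(1 + l * \<tau> / 2) * real_of_ereal (KL \<rho>s (\<rho> k))
       \<le> real_of_ereal (KL \<rho>s (\<rho> (k - 1))) + 2 * \<tau> / l * (tol k)\<^sup>2"
    using int int0 by (simp add: KL_eq del: One_nat_def)
qed


section \<open>The resulting recursion\<close>

lemma KL_recursion:
  assumes S: "inexact_prox_setting l \<tau> \<Theta> F \<rho>s tol \<rho>" and l: "0 < l" and \<tau>: "0 < \<tau>"
    and fin: "KL \<rho>s (\<rho> 0) < \<infinity>"
  obtains K :: "nat \<Rightarrow> real" where "\<And>k. KL \<rho>s (\<rho> k) = ereal (K k)" "\<And>k. 0 \<le> K k"
    "\<And>k. (1 + l * \<tau> / 2) * K (Suc k) \<le> K k + 2 * \<tau> / l * (tol (Suc k))\<^sup>2"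
proof -
  have step: "0 \<le> KL \<rho>s (\<rho> k)" "KL \<rho>s (\<rho> (Suc k)) < \<infinity>"
    "(1 + l * \<tau> / 2) * real_of_ereal (KL \<rho>s (\<rho> (Suc k)))
       \<le> real_of_ereal (KL \<rho>s (\<rho> k)) + 2 * \<tau> / l * (tol (Suc k))\<^sup>2"
    if "KL \<rho>s (\<rho> k) < \<infinity>" for k
    using KL_prox_step[OF S l \<tau>, of "Suc k"] that by simp_all
  have fin': "KL \<rho>s (\<rho> k) < \<infinity>" for k
    by (induction k) (use fin step(2) in auto)
  show thesis
  proof
    show "KL \<rho>s (\<rho> k) = ereal (real_of_ereal (KL \<rho>s (\<rho> k)))" for k
      using fin'[of k] step(1)[OF fin', of k] by (cases "KL \<rho>s (\<rho> k)") auto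
    show "0 \<le> real_of_ereal (KL \<rho>s (\<rho> k))" for k
      using step(1)[OF fin', of k] by (rule real_of_ereal_pos)
  qed (rule step(3)[OF fin'])
qed

text \<open>The sequence \<open>b \<epsilon>\<^bsup>2k\<^esup>\<close> solves the recursion with equality when \<open>b (q - 1 / \<epsilon>\<^sup>2) = c \<kappa>\<^sup>2\<close>;
  the remainder decays like \<open>q\<^bsup>-k\<^esup>\<close>. Depending on the sign of \<open>b\<close>, one of the two
  contributions of \<open>b\<close> is negative and can be dropped.\<close>

lemma geometric_perturbation:
  fixes K s :: "nat \<Rightarrow> real"
  assumes step: "\<And>k. q * K (Suc k) \<le> K k + c * s (Suc k)"
    and s: "\<And>k. 1 \<le> k \<Longrightarrow> s k \<le> (\<kappa> * \<epsilon> ^ k)\<^sup>2"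
    and K0: "0 \<le> K 0" and c: "0 \<le> c" and q: "0 < q" and \<epsilon>: "0 < \<epsilon>" and ne: "q \<noteq> 1 / \<epsilon>\<^sup>2"
  shows "K k \<le> (c / \<bar>q - 1 / \<epsilon>\<^sup>2\<bar> * \<kappa>\<^sup>2 + K 0) / min (1 / \<epsilon>\<^sup>2) q ^ k"
proof -
  define b where "b = c * \<kappa>\<^sup>2 / (q - 1 / \<epsilon>\<^sup>2)"
  define m where "m = min (1 / \<epsilon>\<^sup>2) q"
  have b: "c * \<kappa>\<^sup>2 = b * (q - 1 / \<epsilon>\<^sup>2)"
    using ne by (simp add: b_def)
  have sol: "K k \<le> (K 0 - b) / q ^ k + b * (\<epsilon>\<^sup>2) ^ k"
  proof (induction k)
    case (Suc k)
    have "q * K (Suc k) \<le> K k + c * (\<kappa> * \<epsilon> ^ Suc k)\<^sup>2"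
      using step[of k] mult_left_mono[OF s[of "Suc k"] c] by simp
    also have "c * (\<kappa> * \<epsilon> ^ Suc k)\<^sup>2 = c * \<kappa>\<^sup>2 * (\<epsilon>\<^sup>2 * (\<epsilon>\<^sup>2) ^ k)"
      by (simp add: power_mult_distrib power_mult[symmetric] mult.commute)
    also have "\<dots> = b * q * (\<epsilon>\<^sup>2 * (\<epsilon>\<^sup>2) ^ k) - b * (\<epsilon>\<^sup>2) ^ k"
      unfolding b using \<epsilon> by (simp add: field_simps)
    also have "K k + (b * q * (\<epsilon>\<^sup>2 * (\<epsilon>\<^sup>2) ^ k) - b * (\<epsilon>\<^sup>2) ^ k)
        \<le> (K 0 - b) / q ^ k + b * q * (\<epsilon>\<^sup>2 * (\<epsilon>\<^sup>2) ^ k)"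
      using Suc by simp
    also have "\<dots> = q * ((K 0 - b) / q ^ Suc k + b * (\<epsilon>\<^sup>2) ^ Suc k)"
      using q by (simp add: field_simps)
    finally show ?case
      using q by (simp only: mult_le_cancel_left_pos)
  qed simp
  have m: "0 < m"
    using q \<epsilon> by (simp add: m_def)
  have "m ^ k \<le> q ^ k" "m ^ k \<le> (1 / \<epsilon>\<^sup>2) ^ k"
    using m by (auto intro!: power_mono simp: m_def)
  then have decay: "1 / q ^ k \<le> 1 / m ^ k" "(\<epsilon>\<^sup>2) ^ k \<le> 1 / m ^ k"
    using m q \<epsilon> by (auto simp: field_simps power_divide)
  have "K k \<le> (K 0 + \<bar>b\<bar>) / m ^ k"
  proof (cases "0 \<le> b")
    case True
    have "(K 0 - b) / q ^ k \<le> K 0 * (1 / q ^ k)"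
      using True q by (simp add: divide_right_mono)
    also have "\<dots> \<le> K 0 * (1 / m ^ k)"
      using K0 decay by (intro mult_left_mono)
    finally show ?thesis
      using sol mult_left_mono[OF decay(2) True] True by (simp add: add_divide_distrib)
  next
    case False
    have "b * (\<epsilon>\<^sup>2) ^ k \<le> 0"
      using False by (intro mult_nonpos_nonneg) auto
    moreover have "(K 0 - b) * (1 / q ^ k) \<le> (K 0 - b) * (1 / m ^ k)"
      using False K0 decay by (intro mult_left_mono) auto
    ultimately show ?thesis
      using sol False by simp
  qed
  also have "\<bar>b\<bar> = c / \<bar>q - 1 / \<epsilon>\<^sup>2\<bar> * \<kappa>\<^sup>2"
    using c by (simp add: b_def abs_mult)
  finally show ?thesis
    by (simp add: m_def add.commute)
qed

lemma unrolled_recursion: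
  fixes K s :: "nat \<Rightarrow> real"
  assumes step: "\<And>k. q * K (Suc k) \<le> K k + c * s (Suc k)" and q: "0 < q"
  shows "K k \<le> K 0 / q ^ k + c * (\<Sum>i<k. s (k - i) / q ^ Suc i)"
proof (induction k)
  case (Suc k)
  have "(\<Sum>i<Suc k. s (Suc k - i) / q ^ Suc i) = (s (Suc k) + (\<Sum>i<k. s (k - i) / q ^ Suc i)) / q"
    by (simp add: sum.lessThan_Suc_shift add_divide_distrib sum_divide_distrib mult.commute
             del: sum.lessThan_Suc)
  moreover have "K (Suc k) \<le> (K k + c * s (Suc k)) / q"
    using step[of k] q by (simp add: field_simps)
  moreover have "(K k + c * s (Suc k)) / q
      \<le> (K 0 / q ^ k + c * (\<Sum>i<k. s (k - i) / q ^ Suc i) + c * s (Suc k)) / q"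
    using Suc q by (intro divide_right_mono) auto
  ultimately show ?case
    by (simp add: add_divide_distrib distrib_left mult.commute)
qed simp

lemma summable_polynomial_over_geometric:
  fixes q a :: real
  assumes "1 < q"
  shows "summable (\<lambda>i. real (Suc i) powr a / q ^ Suc i)"
proof -
  define t where "t = ln q / 2"
  have t: "0 < t" and q: "q = exp (2 * t)"
    using assms by (simp_all add: t_def)
  have "summable (\<lambda>i. norm (exp (- t) ^ i))"
    using t by (subst norm_power, intro summable_geometric) simp
  moreover have "(\<lambda>i. real (Suc i) powr a / exp (2 * t * real (Suc i))) \<in> O(\<lambda>i. exp (- t * real i))"
    using t by real_asymp
  then have "(\<lambda>i. real (Suc i) powr a / q ^ Suc i) \<in> O(\<lambda>i. exp (- t) ^ i)"
    unfolding q exp_of_nat_mult[symmetric] by (simp only: mult.commute)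
  ultimately show ?thesis
    by (rule summable_comparison_test_bigo)
qed

text \<open>An error made \<open>i\<close> steps ago is larger than the latest one by a factor at most
  \<open>(k / (k - i))\<^bsup>2\<alpha>\<^esup> \<le> (i + 1)\<^bsup>2\<alpha>\<^esup>\<close>, but carries the weight \<open>q\<^bsup>-(i+1)\<^esup>\<close>. The series of
  these products converges, and its sum is the constant.\<close>

lemma polynomial_perturbation:
  fixes K s :: "nat \<Rightarrow> real"
  assumes step: "\<And>k. q * K (Suc k) \<le> K k + c * s (Suc k)"
    and s: "\<And>k. 1 \<le> k \<Longrightarrow> s k \<le> (\<epsilon> * real k powr (- \<alpha>))\<^sup>2"
    and c: "0 \<le> c" and q: "1 < q" and \<alpha>: "0 \<le> \<alpha>" and k: "1 \<le> k"
  shows "K k \<le> K 0 / q ^ k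
    + c * (\<Sum>i. real (Suc i) powr (2 * \<alpha>) / q ^ Suc i) * \<epsilon>\<^sup>2 / real k powr (2 * \<alpha>)"
proof -
  let ?w = "\<lambda>i. real (Suc i) powr (2 * \<alpha>) / q ^ Suc i"
  have term_le: "s (k - i) / q ^ Suc i \<le> \<epsilon>\<^sup>2 / real k powr (2 * \<alpha>) * ?w i" if i: "i < k" for i
  proof -
    have "real k \<le> real (k - i) * real (Suc i)"
    proof -
      have "k \<le> (k - i) + i * (k - i)"
        using i by (cases "k - i") auto
      then show ?thesis
        by (metis mult.commute mult_Suc of_nat_le_iff of_nat_mult)
    qed
    then have "real k powr (2 * \<alpha>) \<le> real (k - i) powr (2 * \<alpha>) * real (Suc i) powr (2 * \<alpha>)"
      using \<alpha> by (subst powr_mult[symmetric]) (auto intro!: powr_mono2)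
    then have le: "1 / real (k - i) powr (2 * \<alpha>) \<le> real (Suc i) powr (2 * \<alpha>) / real k powr (2 * \<alpha>)"
      using i by (simp add: field_simps)
    have "s (k - i) \<le> \<epsilon>\<^sup>2 * (1 / real (k - i) powr (2 * \<alpha>))"
      using s[of "k - i"] i
      by (simp add: power_mult_distrib powr_minus power_inverse powr_power divide_inverse mult.commute)
    also have "\<dots> \<le> \<epsilon>\<^sup>2 * (real (Suc i) powr (2 * \<alpha>) / real k powr (2 * \<alpha>))"
      using le by (intro mult_left_mono) auto
    finally have "s (k - i) / q ^ Suc i
        \<le> \<epsilon>\<^sup>2 * (real (Suc i) powr (2 * \<alpha>) / real k powr (2 * \<alpha>)) / q ^ Suc i"
      using q by (intro divide_right_mono) auto
    then show ?thesis
      by (simp add: field_simps)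
  qed
  have "(\<Sum>i<k. s (k - i) / q ^ Suc i) \<le> (\<Sum>i<k. \<epsilon>\<^sup>2 / real k powr (2 * \<alpha>) * ?w i)"
    by (intro sum_mono term_le) auto
  also have "\<dots> = \<epsilon>\<^sup>2 / real k powr (2 * \<alpha>) * (\<Sum>i<k. ?w i)"
    by (simp only: sum_distrib_left)
  also have "\<dots> \<le> \<epsilon>\<^sup>2 / real k powr (2 * \<alpha>) * (\<Sum>i. ?w i)"
    using q by (intro mult_left_mono sum_le_suminf summable_polynomial_over_geometric) auto
  finally have "c * (\<Sum>i<k. s (k - i) / q ^ Suc i) \<le> c * (\<epsilon>\<^sup>2 / real k powr (2 * \<alpha>) * (\<Sum>i. ?w i))"
    using c by (rule mult_left_mono)
  then show ?thesis
    using unrolled_recursion[where K = K and s = s and c = c and q = q and k = k, OF step] q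
    by (simp add: mult_ac)
qed

theorem theorem4:
  fixes l \<tau> :: real
  assumes "0 < l" and "0 < \<tau>"
  shows "(\<forall>\<epsilon>::real. 0 < \<epsilon> \<and> \<epsilon> < 1 \<and> \<epsilon> * sqrt (1 + l * \<tau> / 2) \<noteq> 1 \<longrightarrow>
      (\<exists>C>0. \<forall>(\<Theta> :: 'a::euclidean_space set) F \<rho>s tol \<rho> (\<kappa>::real).
         inexact_prox_setting l \<tau> \<Theta> F \<rho>s tol \<rho> \<and> 0 < \<kappa> \<and> (\<forall>k\<ge>1. tol k \<le> \<kappa> * \<epsilon> ^ k) \<longrightarrow>
         (\<forall>k\<ge>1. KL \<rho>s (\<rho> k) \<le>
            (ereal (C * \<kappa>\<^sup>2) + 2 * KL \<rho>s (\<rho> 0))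
              / ereal (min (1 / \<epsilon>\<^sup>2) (1 + l * \<tau> / 2) ^ k))))
    \<and> (\<forall>\<alpha>::real. 0 < \<alpha> \<longrightarrow>
      (\<exists>C>0. \<forall>(\<Theta> :: 'a::euclidean_space set) F \<rho>s tol \<rho> (\<epsilon>::real).
         inexact_prox_setting l \<tau> \<Theta> F \<rho>s tol \<rho> \<and> 0 < \<epsilon> \<and>
         (\<forall>k\<ge>1. tol k \<le> \<epsilon> * real k powr (- \<alpha>)) \<longrightarrow>
         (\<forall>k\<ge>1. KL \<rho>s (\<rho> k) \<le>
            2 * KL \<rho>s (\<rho> 0) / ereal ((1 + l * \<tau> / 2) ^ k)
              + ereal (C * \<epsilon>\<^sup>2 / real k powr (2 * \<alpha>)))))"
proof -
  define q where "q = 1 + l * \<tau> / 2"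
  define c where "c = 2 * \<tau> / l"
  have q: "1 < q" and c: "0 < c"
    using assms by (simp_all add: q_def c_def)
  have tol: "(tol k)\<^sup>2 \<le> B\<^sup>2"
    if "inexact_prox_setting l \<tau> \<Theta> F \<rho>s tol \<rho>" "1 \<le> k" "tol k \<le> B"
    for \<Theta> :: "'a set" and F \<rho>s tol \<rho> k and B :: real
    using that by (auto simp: inexact_prox_setting_def inexact_prox_iterates_def intro: power_mono)
  have geometric: "\<exists>C>0. \<forall>(\<Theta> :: 'a set) F \<rho>s tol \<rho> (\<kappa>::real).
         inexact_prox_setting l \<tau> \<Theta> F \<rho>s tol \<rho> \<and> 0 < \<kappa> \<and> (\<forall>k\<ge>1. tol k \<le> \<kappa> * \<epsilon> ^ k) \<longrightarrow>
         (\<forall>k\<ge>1. KL \<rho>s (\<rho> k) \<le>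
            (ereal (C * \<kappa>\<^sup>2) + 2 * KL \<rho>s (\<rho> 0)) / ereal (min (1 / \<epsilon>\<^sup>2) q ^ k))"
    if \<epsilon>: "0 < \<epsilon>" and ne: "\<epsilon> * sqrt q \<noteq> 1" for \<epsilon> :: real
  proof (intro exI[of _ "c / \<bar>q - 1 / \<epsilon>\<^sup>2\<bar>"] conjI allI impI; (elim conjE)?)
    have ne': "q \<noteq> 1 / \<epsilon>\<^sup>2"
      using ne \<epsilon> by (auto simp: real_sqrt_divide)
    then show "0 < c / \<bar>q - 1 / \<epsilon>\<^sup>2\<bar>"
      using c by simp
    fix \<Theta> :: "'a set" and F \<rho>s tol \<rho> and k :: nat and \<kappa> :: real
    assume S: "inexact_prox_setting l \<tau> \<Theta> F \<rho>s tol \<rho>" and "0 < \<kappa>"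
      and T: "\<forall>k\<ge>1. tol k \<le> \<kappa> * \<epsilon> ^ k" and k: "1 \<le> k"
    define m where "m = min (1 / \<epsilon>\<^sup>2) q ^ k"
    have m: "0 < m"
      using q \<epsilon> by (simp add: m_def)
    have "KL \<rho>s (\<rho> k) \<le> (ereal (c / \<bar>q - 1 / \<epsilon>\<^sup>2\<bar> * \<kappa>\<^sup>2) + 2 * KL \<rho>s (\<rho> 0)) / ereal m"
    proof (cases "KL \<rho>s (\<rho> 0) < \<infinity>")
      case True
      from KL_recursion[OF S assms True] obtain K where K: "\<And>k. KL \<rho>s (\<rho> k) = ereal (K k)"
        and K0: "\<And>k. 0 \<le> K k" and step: "\<And>k. q * K (Suc k) \<le> K k + c * (tol (Suc k))\<^sup>2"
        unfolding q_def c_def by blast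
      have "K k \<le> (c / \<bar>q - 1 / \<epsilon>\<^sup>2\<bar> * \<kappa>\<^sup>2 + K 0) / m"
        unfolding m_def using tol[OF S] T K0 c q \<epsilon> ne'
        by (intro geometric_perturbation[where s = "\<lambda>k. (tol k)\<^sup>2"] step) auto
      also have "\<dots> \<le> (c / \<bar>q - 1 / \<epsilon>\<^sup>2\<bar> * \<kappa>\<^sup>2 + 2 * K 0) / m"
        using K0[of 0] m by (intro divide_right_mono) auto
      finally show ?thesis
        using m by (simp add: K)
    next
      case False
      then show ?thesis
        using m by (simp add: not_less)
    qed
    then show "KL \<rho>s (\<rho> k) \<le> (ereal (c / \<bar>q - 1 / \<epsilon>\<^sup>2\<bar> * \<kappa>\<^sup>2) + 2 * KL \<rho>s (\<rho> 0))
        / ereal (min (1 / \<epsilon>\<^sup>2) q ^ k)"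
      unfolding m_def .
  qed
  have polynomial: "\<exists>C>0. \<forall>(\<Theta> :: 'a set) F \<rho>s tol \<rho> (\<epsilon>::real).
         inexact_prox_setting l \<tau> \<Theta> F \<rho>s tol \<rho> \<and> 0 < \<epsilon> \<and>
         (\<forall>k\<ge>1. tol k \<le> \<epsilon> * real k powr (- \<alpha>)) \<longrightarrow>
         (\<forall>k\<ge>1. KL \<rho>s (\<rho> k) \<le>
            2 * KL \<rho>s (\<rho> 0) / ereal (q ^ k) + ereal (C * \<epsilon>\<^sup>2 / real k powr (2 * \<alpha>)))"
    if \<alpha>: "0 < \<alpha>" for \<alpha> :: real
  proof (intro exI[of _ "c * (\<Sum>i. real (Suc i) powr (2 * \<alpha>) / q ^ Suc i)"] conjI allI impI; (elim conjE)?)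
    show "0 < c * (\<Sum>i. real (Suc i) powr (2 * \<alpha>) / q ^ Suc i)"
      using q c by (intro mult_pos_pos suminf_pos summable_polynomial_over_geometric) auto
    fix \<Theta> :: "'a set" and F \<rho>s tol \<rho> and k :: nat and \<epsilon> :: real
    assume S: "inexact_prox_setting l \<tau> \<Theta> F \<rho>s tol \<rho>" and "0 < \<epsilon>"
      and T: "\<forall>k\<ge>1. tol k \<le> \<epsilon> * real k powr (- \<alpha>)" and k: "1 \<le> k"
    have qk: "0 < q ^ k"
      using q by simp
    show "KL \<rho>s (\<rho> k) \<le> 2 * KL \<rho>s (\<rho> 0) / ereal (q ^ k)
        + ereal (c * (\<Sum>i. real (Suc i) powr (2 * \<alpha>) / q ^ Suc i) * \<epsilon>\<^sup>2 / real k powr (2 * \<alpha>))"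
    proof (cases "KL \<rho>s (\<rho> 0) < \<infinity>")
      case True
      from KL_recursion[OF S assms True] obtain K where K: "\<And>k. KL \<rho>s (\<rho> k) = ereal (K k)"
        and K0: "\<And>k. 0 \<le> K k" and step: "\<And>k. q * K (Suc k) \<le> K k + c * (tol (Suc k))\<^sup>2"
        unfolding q_def c_def by blast
      have "K k \<le> K 0 / q ^ k
          + c * (\<Sum>i. real (Suc i) powr (2 * \<alpha>) / q ^ Suc i) * \<epsilon>\<^sup>2 / real k powr (2 * \<alpha>)"
        using tol[OF S] T c q \<alpha> k
        by (intro polynomial_perturbation[where s = "\<lambda>k. (tol k)\<^sup>2"] step) auto
      moreover have "K 0 / q ^ k \<le> 2 * K 0 / q ^ k"
        using K0[of 0] qk by (intro divide_right_mono) auto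
      ultimately show ?thesis
        using qk q by (simp add: K del: power_Suc)
    next
      case False
      then show ?thesis
        using qk by (simp add: not_less)
    qed
  qed
  show ?thesis
    using geometric polynomial unfolding q_def by blast
qed

end
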